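(* Let $d\ge 1$ and let $P\subset\mathbb{TA}^d$ be a $d$-polytrope, i.e. a polytrope of dimension $d$ in $\mathbb{TA}^d$. For $i,j\in\{0,\dots,d\}$ with $i\ne j$ let $c_{ij}$ be the right hand side of the tight inequality $x_i-x_j\le c_{ij}$ for $P$, that is, $c_{ij}=\max\{x_i-x_j \mid x\in P\}$, so that $P$ is the set of all $x\in\mathbb{TA}^d$ with $x_i-x_j\le c_{ij}$ for all $i\ne j$. For $i\in\{0,\dots,d\}$ let $v_i\in\mathbb{TA}^d$ be the point with coordinates $$v_{ii}=0\quad\text{and}\quad v_{ik}=c_{ki}\ \text{ for } k\ne i .$$ Then the $d+1$ points $v_0,v_1,\dots,v_d$ are the tropical vertices of $P$. In particular, each $d$-polytrope in $\mathbb{TA}^d$ is a tropical $d$-simplex.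
   Context: Tropical addition is $x\oplus y=\min(x,y)$ and tropical multiplication is $x\odot y=x+y$ on $\mathbb{R}$. On $\mathbb{R}^{d+1}$ (coordinates indexed by $0,\dots,d$) tropical addition is componentwise, and $\lambda\odot x=x+\lambda(1,\dots,1)$. The tropical affine space is $\mathbb{TA}^d=\mathbb{R}^{d+1}/\mathbb{R}(1,\dots,1)$; differences $x_i-x_j$ of coordinates are well defined on it. It is identified with $\mathbb{R}^d$ via $c_0:(\xi_0,\dots,\xi_d)\mapsto(\xi_1-\xi_0,\dots,\xi_d-\xi_0)$, which also gives its topology. A subset $S$ of $\mathbb{TA}^d$ is tropically convex if for all $x,y\in S$ and $\lambda,\mu\in\mathbb{R}$ the point $(\lambda\odot x)\oplus(\mu\odot y)$ lies in $S$; $\operatorname{tconv}$ denotes the tropical convex hull. A tropical polytope is the tropical convex hull of finitely many points of $\mathbb{TA}^d$. Each tropical polytope $P$ has a unique inclusion-minimal set of generators (i.e. of points whose tropical convex hull is $P$); its elements are the tropical vertices of $P$. A polytrope is a tropical polytope $P$ such that $c_0(P)\subset\mathbb{R}^d$ is convex in the ordinary sense; its dimension is the dimension of $c_0(P)$. It is known that the polytropes in $\mathbb{TA}^d$ are exactly the non-empty bounded sets of the form $\{x \mid x_i-x_j\le c_{ij} \text{ for } (i,j)\in J\}$ with $J$ a set of pairs $(i,j)$, $i\neq j$, in $\{0,\dots,d\}$ and $c_{ij}\in\mathbb{R}$. For $0\le k\le d$ let $\bar S_k=\{x\in\mathbb{TA}^d \mid x_i\ge x_k \text{ for all } i\}$,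 and for $I\subset\{0,\dots,d\}$ let $\bar S_I=\bigcup_{i\in I}\bar S_i$. A closed tropical halfspace is a set $w+\bar S_I$ with $w\in\mathbb{TA}^d$ (its apex) and $1\le \#I\le d$. A tropical $d$-simplex in $\mathbb{TA}^d$ is the tropical convex hull of $d+1$ points in $\mathbb{TA}^d$ which are not all contained in the boundary of a single tropical halfspace. *)

theory Defs
  imports "HOL-Analysis.Analysis"
begin

(* The dimension is d = CARD('d), which is at least 1 because types are nonempty.  The d+1
   homogeneous coordinates 0,...,d are indexed by 'd option: None is the coordinate 0 that
   c_0 singles out, and Some k ranges over the coordinates 1,...,d. *)

definition trop_add :: "real ^ 'n \<Rightarrow> real ^ 'n \<Rightarrow> real ^ 'n" where
  "trop_add x y = (\<chi> i. min (x $ i) (y $ i))"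

definition trop_scale :: "real \<Rightarrow> real ^ 'n \<Rightarrow> real ^ 'n" where
  "trop_scale l x = (\<chi> i. l + x $ i)"

definition trop_equiv :: "real ^ 'n \<Rightarrow> real ^ 'n \<Rightarrow> bool" where
  "trop_equiv x y \<longleftrightarrow> (\<exists>l. y = trop_scale l x)"

lemma equivp_trop_equiv: "equivp trop_equiv"
proof (rule equivpI)
  show "reflp trop_equiv"
  proof (rule reflpI)
    fix x :: "real ^ 'n"
    have "x = trop_scale 0 x" by (simp add: trop_scale_def)
    then show "trop_equiv x x" unfolding trop_equiv_def by blast
  qed
  show "symp trop_equiv"
  proof (rule sympI)
    fix x y :: "real ^ 'n" assume "trop_equiv x y"
    then obtain l where "y = trop_scale l x" by (auto simp: trop_equiv_def)
    then have "x = trop_scale (- l) y" by (simp add: trop_scale_def vec_eq_iff)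
    then show "trop_equiv y x" by (auto simp: trop_equiv_def)
  qed
  show "transp trop_equiv"
  proof (rule transpI)
    fix x y z :: "real ^ 'n" assume "trop_equiv x y" "trop_equiv y z"
    then obtain l m where "y = trop_scale l x" "z = trop_scale m y" by (auto simp: trop_equiv_def)
    then have "z = trop_scale (m + l) x" by (simp add: trop_scale_def vec_eq_iff)
    then show "trop_equiv x z" by (auto simp: trop_equiv_def)
  qed
qed

quotient_type 'd tropical_affine = "real ^ ('d::finite) option" / trop_equiv
  by (rule equivp_trop_equiv)

lift_definition coord_diff :: "('d::finite) tropical_affine \<Rightarrow> 'd option \<Rightarrow> 'd option \<Rightarrow> real"
  is "\<lambda>x i j. x $ i - x $ j"
  by (auto simp: trop_equiv_def trop_scale_def fun_eq_iff)

lift_definition c0 :: "('d::finite) tropical_affine \<Rightarrow> real ^ 'd"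
  is "\<lambda>x. \<chi> k. x $ Some k - x $ None"
  by (auto simp: trop_equiv_def trop_scale_def vec_eq_iff)

lemma bij_c0: "bij (c0 :: ('a::finite) tropical_affine \<Rightarrow> real ^ 'a)"
proof (rule bijI)
  have coord: "trop_equiv x y"
    if eq: "(\<chi> k. x $ Some k - x $ None) = ((\<chi> k. y $ Some k - y $ None) :: real ^ 'a)"
    for x y :: "real ^ 'a option"
  proof -
    have "y $ i = (y $ None - x $ None) + x $ i" for i
    proof (cases i)
      case (Some k)
      have "x $ Some k - x $ None = y $ Some k - y $ None"
        using arg_cong[OF eq, of "\<lambda>z. z $ k"] by simp
      then show ?thesis using Some by simp
    qed simp
    then have "y = trop_scale (y $ None - x $ None) x"
      unfolding trop_scale_def vec_eq_iff vec_lambda_beta by blast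
    then show "trop_equiv x y" unfolding trop_equiv_def by blast
  qed
  show "inj (c0 :: 'a tropical_affine \<Rightarrow> real ^ 'a)"
  proof (rule injI)
    fix p q :: "'a tropical_affine"
    obtain x y where xy: "p = abs_tropical_affine x" "q = abs_tropical_affine y"
      by (metis Quotient_abs_rep[OF Quotient_tropical_affine])
    assume "c0 p = c0 q"
    then have "trop_equiv x y" by (intro coord) (simp add: xy c0.abs_eq)
    then show "p = q" by (simp add: xy tropical_affine.abs_eq_iff)
  qed
  show "surj (c0 :: 'a tropical_affine \<Rightarrow> real ^ 'a)"
  proof (rule surjI)
    fix u :: "real ^ 'a"
    show "c0 (abs_tropical_affine (\<chi> i. case i of None \<Rightarrow> 0 | Some k \<Rightarrow> u $ k)) = u"
      by (simp add: c0.abs_eq vec_eq_iff)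
  qed
qed

instantiation tropical_affine :: (finite) topological_space
begin

definition open_tropical_affine :: "'a tropical_affine set \<Rightarrow> bool" where
  "open_tropical_affine S \<longleftrightarrow> open (c0 ` S)"

instance
proof
  have inj: "inj (c0 :: 'a tropical_affine \<Rightarrow> _)" and surj: "surj (c0 :: 'a tropical_affine \<Rightarrow> _)"
    using bij_c0 by (auto simp: bij_def)
  show "open (UNIV :: 'a tropical_affine set)"
    using surj by (simp add: open_tropical_affine_def)
  show "open (S \<inter> T)" if "open S" "open T" for S T :: "'a tropical_affine set"
    using that by (simp add: open_tropical_affine_def image_Int[OF inj] open_Int)
  show "open (\<Union>K)" if "\<forall>S\<in>K. open S" for K :: "'a tropical_affine set set"
    using that by (auto simp: open_tropical_affine_def image_Union)
qed

end

instantiation tropical_affine :: (finite) plus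
begin

lift_definition plus_tropical_affine ::
  "'a tropical_affine \<Rightarrow> 'a tropical_affine \<Rightarrow> 'a tropical_affine" is "(+)"
proof -
  fix x x' y y' :: "real ^ 'a option"
  assume "trop_equiv x x'" "trop_equiv y y'"
  then obtain l m where "x' = trop_scale l x" "y' = trop_scale m y" by (auto simp: trop_equiv_def)
  then have "x' + y' = trop_scale (l + m) (x + y)" by (simp add: trop_scale_def vec_eq_iff)
  then show "trop_equiv (x + y) (x' + y')" by (auto simp: trop_equiv_def)
qed

instance ..

end

(* A single combination depends on the chosen representatives, the condition for all l, m
   does not. *)
definition tropically_convex :: "('d::finite) tropical_affine set \<Rightarrow> bool" where
  "tropically_convex S \<longleftrightarrow>
     (\<forall>x y l m. abs_tropical_affine x \<in> S \<longrightarrow> abs_tropical_affine y \<in> S \<longrightarrow>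
        abs_tropical_affine (trop_add (trop_scale l x) (trop_scale m y)) \<in> S)"

definition tconv :: "('d::finite) tropical_affine set \<Rightarrow> 'd tropical_affine set" where
  "tconv S = tropically_convex hull S"

definition tropical_polytope :: "('d::finite) tropical_affine set \<Rightarrow> bool" where
  "tropical_polytope P \<longleftrightarrow> (\<exists>V. finite V \<and> V \<noteq> {} \<and> P = tconv V)"

definition minimal_generators ::
  "('d::finite) tropical_affine set \<Rightarrow> 'd tropical_affine set \<Rightarrow> bool" where
  "minimal_generators P V \<longleftrightarrow> tconv V = P \<and> (\<forall>W. W \<subset> V \<longrightarrow> tconv W \<noteq> P)"

definition tropical_vertices :: "('d::finite) tropical_affine set \<Rightarrow> 'd tropical_affine set" where
  "tropical_vertices P = (THE V. minimal_generators P V)"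

definition polytrope :: "('d::finite) tropical_affine set \<Rightarrow> bool" where
  "polytrope P \<longleftrightarrow> tropical_polytope P \<and> convex (c0 ` P)"

definition polytrope_dim :: "('d::finite) tropical_affine set \<Rightarrow> int" where
  "polytrope_dim P = aff_dim (c0 ` P)"

definition closed_sector :: "('d::finite) option \<Rightarrow> 'd tropical_affine set" where
  "closed_sector k = {x. \<forall>i. coord_diff x i k \<ge> 0}"

definition closed_tropical_halfspace :: "('d::finite) tropical_affine set \<Rightarrow> bool" where
  "closed_tropical_halfspace H \<longleftrightarrow>
     (\<exists>w I. 1 \<le> card I \<and> card I \<le> CARD('d) \<and> H = (\<lambda>x. w + x) ` (\<Union>i\<in>I. closed_sector i))"

definition tropical_simplex :: "('d::finite) tropical_affine set \<Rightarrow> bool" where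
  "tropical_simplex P \<longleftrightarrow>
     (\<exists>V. card V = CARD('d) + 1 \<and> P = tconv V \<and>
        \<not> (\<exists>H. closed_tropical_halfspace H \<and> V \<subseteq> frontier H))"

definition tight_rhs :: "('d::finite) tropical_affine set \<Rightarrow> 'd option \<Rightarrow> 'd option \<Rightarrow> real" where
  "tight_rhs P i j = (GREATEST r. r \<in> (\<lambda>x. coord_diff x i j) ` P)"

definition tight_vertex :: "('d::finite) tropical_affine set \<Rightarrow> 'd option \<Rightarrow> 'd tropical_affine" where
  "tight_vertex P i = abs_tropical_affine (\<chi> k. if k = i then 0 else tight_rhs P k i)"

end

(* Normalise the points of P by x_j = 0 and order them coordinatewise. Every point lies below one of
   the finitely many generators; let p be a maximal generator. For another point q of P, ordinary
   convexity puts the points p + e (q - p) into P, and for small e > 0 each generator above such a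
   point is also above p, hence equal to p. So q lies below p, that is, p is the greatest element
   of P, and then p = v_j. Consequently a point x satisfying all the tight inequalities is the
   tropical combination of the v_j with coefficients x_j, and a set generating P has to contain the
   greatest elements v_j. Finally, if z is an interior point of P and w is the apex of a tropical
   halfspace, take j maximising w_j - z_j: the minimal coordinate of v_j - w is attained only at j,
   so v_j is not on the boundary of the halfspace. *)
theory Submission
  imports Defs
begin

section \<open>Coordinates\<close>

lemma ex_abs_tropical_affine: obtains X where "x = abs_tropical_affine X"
  by (metis Quotient_abs_rep[OF Quotient_tropical_affine])

lemma coord_diff_same [simp]: "coord_diff x i i = 0"
  by transfer simp

lemma coord_diff_swap: "coord_diff x j i = - coord_diff x i j"
  by transfer simp

lemma coord_diff_split: "coord_diff x i k = coord_diff x i j + coord_diff x j k"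
  by transfer simp

lemma coord_diff_plus: "coord_diff (x + y) i j = coord_diff x i j + coord_diff y i j"
  by transfer simp

lemma tropical_affine_eqI:
  assumes "\<And>k. coord_diff x k j = coord_diff y k j"
  shows "x = y"
proof -
  obtain X Y where X: "x = abs_tropical_affine X" and Y: "y = abs_tropical_affine Y"
    by (metis ex_abs_tropical_affine)
  have "Y $ k = (Y $ j - X $ j) + X $ k" for k
    using assms[of k] by (simp add: X Y coord_diff.abs_eq)
  then have "Y = trop_scale (Y $ j - X $ j) X"
    unfolding trop_scale_def vec_eq_iff vec_lambda_beta by blast
  then show ?thesis
    by (auto simp: X Y tropical_affine.abs_eq_iff trop_equiv_def)
qed

text \<open>The vertices 0, e_1, ..., e_d of the standard simplex. Through \<open>c0\<close> they
  turn differences of coordinates into linear functionals, which links the tropical data with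
  ordinary convexity and topology.\<close>

definition option_axis :: "('d::finite) option \<Rightarrow> real ^ 'd" where
  "option_axis i = (case i of None \<Rightarrow> 0 | Some k \<Rightarrow> axis k 1)"

lemma inj_option_axis: "inj option_axis"
  by (auto simp: inj_def option_axis_def axis_eq_axis axis_eq_0_iff eq_commute[of 0] split: option.splits)

lemma coord_diff_c0: "coord_diff x i j = (option_axis i - option_axis j) \<bullet> c0 x"
  by transfer (auto simp: option_axis_def inner_diff_left inner_axis' split: option.split)

section \<open>Tropical convex hulls\<close>

lemma subset_tconv: "W \<subseteq> tconv W"
  unfolding tconv_def by (rule hull_subset)

lemma tropically_convex_tconv: "tropically_convex (tconv W)"
  unfolding tconv_def
  by (rule hull_in) (auto simp: tropically_convex_def)

lemma tconv_minimal: "W \<subseteq> S \<Longrightarrow> tropically_convex S \<Longrightarrow> tconv W \<subseteq> S"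
  unfolding tconv_def by (rule hull_minimal)

lemma coord_diff_trop_add:
  "coord_diff (abs_tropical_affine (trop_add (trop_scale l X) (trop_scale m Y))) k j =
     min (l + X $ k) (m + Y $ k) - min (l + X $ j) (m + Y $ j)"
  by (simp add: coord_diff.abs_eq trop_add_def trop_scale_def)

text \<open>The points lying below some point of \<open>W\<close> after normalisation at
  \<open>j\<close> form a tropically convex set: a combination lies below whichever of its terms
  attains the minimum at \<open>j\<close>.\<close>

lemma tconv_dominated:
  assumes "x \<in> tconv W"
  obtains w where "w \<in> W" "\<And>k. coord_diff x k j \<le> coord_diff w k j"
proof -
  let ?S = "{x. \<exists>w\<in>W. \<forall>k. coord_diff x k j \<le> coord_diff w k j}"
  have "tropically_convex ?S"
    unfolding tropically_convex_def
  proof (intro allI impI)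
    fix X Y :: "real ^ 'a option" and l m
    assume "abs_tropical_affine X \<in> ?S" "abs_tropical_affine Y \<in> ?S"
    then obtain u v where u: "u \<in> W" "\<And>k. X $ k - X $ j \<le> coord_diff u k j"
      and v: "v \<in> W" "\<And>k. Y $ k - Y $ j \<le> coord_diff v k j"
      by (auto simp: coord_diff.abs_eq)
    show "abs_tropical_affine (trop_add (trop_scale l X) (trop_scale m Y)) \<in> ?S"
    proof (cases "l + X $ j \<le> m + Y $ j")
      case True
      have "min (l + X $ k) (m + Y $ k) - min (l + X $ j) (m + Y $ j) \<le> coord_diff u k j" for k
        using True u(2)[of k] by linarith
      then show ?thesis using u(1) by (auto simp: coord_diff_trop_add)
    next
      case False
      have "min (l + X $ k) (m + Y $ k) - min (l + X $ j) (m + Y $ j) \<le> coord_diff v k j" for k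
        using False v(2)[of k] by linarith
      then show ?thesis using v(1) by (auto simp: coord_diff_trop_add)
    qed
  qed
  moreover have "W \<subseteq> ?S" by auto
  ultimately have "tconv W \<subseteq> ?S" by (rule tconv_minimal[rotated])
  with assms that show thesis by blast
qed

lemma tropically_convex_Min:
  assumes S: "tropically_convex S" and "finite F" "F \<noteq> {}"
    and "\<And>j. j \<in> F \<Longrightarrow> abs_tropical_affine (Y j) \<in> S"
  shows "abs_tropical_affine (\<chi> k. Min ((\<lambda>j. Y j $ k) ` F)) \<in> S"
  using assms(2-)
proof (induction F rule: finite_ne_induct)
  case (singleton j)
  then show ?case by simp
next
  case (insert j F)
  let ?Z = "\<chi> k. Min ((\<lambda>j. Y j $ k) ` F)"
  have "abs_tropical_affine (trop_add (trop_scale 0 (Y j)) (trop_scale 0 ?Z)) \<in> S"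
    using S insert unfolding tropically_convex_def by blast
  moreover have "trop_add (trop_scale 0 (Y j)) (trop_scale 0 ?Z) =
      (\<chi> k. Min ((\<lambda>j. Y j $ k) ` insert j F))"
    using insert by (simp add: trop_add_def trop_scale_def vec_eq_iff)
  ultimately show ?case by simp
qed

text \<open>\<open>x\<close> is the tropical combination of the points \<open>p j\<close> with
  coefficients x_j: at coordinate k the term j = k contributes x_k, and \<open>le\<close> keeps
  every other term at or above it.\<close>

lemma tropically_convex_memI:
  assumes S: "tropically_convex S" and p: "\<And>j. p j \<in> S"
    and le: "\<And>j k. coord_diff x k j \<le> coord_diff (p j) k j"
  shows "x \<in> S"
proof -
  obtain X where X: "x = abs_tropical_affine X" by (rule ex_abs_tropical_affine)
  \<comment> \<open>The representative of \<open>p j\<close> whose coordinate j equals that of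
    \<open>X\<close>.\<close>
  define Y where "Y j = (\<chi> k. X $ j + coord_diff (p j) k j)" for j
  have "abs_tropical_affine (Y j) = p j" for j
    by (rule tropical_affine_eqI[of _ j]) (simp add: Y_def coord_diff.abs_eq)
  then have "abs_tropical_affine (\<chi> k. Min (range (\<lambda>j. Y j $ k))) \<in> S"
    using p by (intro tropically_convex_Min[OF S]) auto
  moreover have "Min (range (\<lambda>j. Y j $ k)) = X $ k" for k
  proof (rule Min_eqI)
    show "X $ k \<le> y" if "y \<in> range (\<lambda>j. Y j $ k)" for y
      using that le[of k] by (auto simp: Y_def X coord_diff.abs_eq algebra_simps)
    show "X $ k \<in> range (\<lambda>j. Y j $ k)"
      by (rule image_eqI[of _ _ k]) (simp_all add: Y_def)
  qed simp
  ultimately show ?thesis by (simp add: X)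
qed

section \<open>Greatest elements and tight inequalities\<close>

lemma convex_tconv_greatest:
  assumes fin: "finite W" "W \<noteq> {}" and conv: "convex (c0 ` tconv W)"
  obtains p where "p \<in> tconv W" "\<And>q k. q \<in> tconv W \<Longrightarrow> coord_diff q k j \<le> coord_diff p k j"
proof -
  let ?f = "\<lambda>w k. coord_diff w k j"
  \<comment> \<open>The quotient carries no order, so maximality is taken among the coordinate
    functions normalised at \<open>j\<close>.\<close>
  obtain g where g: "g \<in> ?f ` W" and max_g: "\<forall>h\<in>?f ` W. g \<le> h \<longrightarrow> g = h"
    using finite_has_maximal[of "?f ` W"] fin by auto
  obtain p where p: "p \<in> W" and gp: "g = ?f p" using g by blast
  have pW: "p \<in> tconv W" using p subset_tconv by blast
  have max: "?f w = ?f p" if "w \<in> W" "\<And>k. coord_diff p k j \<le> coord_diff w k j" for w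
    using max_g that by (auto simp: gp le_fun_def)
  have "coord_diff q k j \<le> coord_diff p k j" if q: "q \<in> tconv W" for q k
  proof -
    define s where "s e k = coord_diff p k j + e * (coord_diff q k j - coord_diff p k j)" for e k
    \<comment> \<open>If \<open>w\<close> is not above \<open>p\<close>, it is strictly below
      \<open>p\<close> at some coordinate and, by continuity, strictly below \<open>s e\<close>
      there for all small e. Finiteness of \<open>W\<close> then yields one e for all
      generators.\<close>
    have "\<forall>\<^sub>F e in at_right 0. (\<forall>k. s e k \<le> coord_diff w k j) \<longrightarrow>
        (\<forall>k. coord_diff p k j \<le> coord_diff w k j)" for w
    proof (cases "\<forall>k. coord_diff p k j \<le> coord_diff w k j")
      case False
      then obtain k where k: "coord_diff w k j < coord_diff p k j" by (auto simp: not_le)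
      have "((\<lambda>e. s e k) \<longlongrightarrow> s 0 k) (at_right 0)"
        unfolding s_def by (intro tendsto_intros)
      then have "\<forall>\<^sub>F e in at_right 0. coord_diff w k j < s e k"
        using k by (intro order_tendstoD) (auto simp: s_def)
      then show ?thesis by eventually_elim (use not_le in blast)
    qed simp
    then have "\<forall>\<^sub>F e in at_right 0. \<forall>w\<in>W. (\<forall>k. s e k \<le> coord_diff w k j) \<longrightarrow>
        (\<forall>k. coord_diff p k j \<le> coord_diff w k j)"
      using fin by (intro eventually_ball_finite) auto
    moreover have "\<forall>\<^sub>F e in at_right (0::real). e \<in> {0<..<1}"
      by (rule eventually_at_right_real) simp
    ultimately have "\<forall>\<^sub>F e in at_right 0. e \<in> {0<..<1} \<and>
        (\<forall>w\<in>W. (\<forall>k. s e k \<le> coord_diff w k j) \<longrightarrow> (\<forall>k. coord_diff p k j \<le> coord_diff w k j))"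
      by eventually_elim simp
    from eventually_happens[OF this] obtain e :: real where e: "0 < e" "e < 1"
      and small: "\<And>w. w \<in> W \<Longrightarrow> \<forall>k. s e k \<le> coord_diff w k j \<Longrightarrow>
        \<forall>k. coord_diff p k j \<le> coord_diff w k j"
      by (auto simp: trivial_limit_at_right_real)
    have "(1 - e) *\<^sub>R c0 p + e *\<^sub>R c0 q \<in> c0 ` tconv W"
      using e pW q by (intro convexD_alt[OF conv]) auto
    then obtain r where r: "r \<in> tconv W" "c0 r = (1 - e) *\<^sub>R c0 p + e *\<^sub>R c0 q"
      by auto
    have rs: "coord_diff r k j = s e k" for k
      by (simp add: coord_diff_c0 r(2) s_def inner_add_right algebra_simps)
    obtain w where w: "w \<in> W" "\<And>k. s e k \<le> coord_diff w k j"
      using tconv_dominated[OF r(1), of j] by (auto simp: rs)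
    \<comment> \<open>Being above \<open>s e\<close>, the generator \<open>w\<close> is above
      \<open>p\<close> and so agrees with it by maximality. Hence \<open>s e\<close> is below
      \<open>p\<close>, and dividing by e > 0 puts \<open>q\<close> below \<open>p\<close>.\<close>
    have "?f w = ?f p"
      using w by (intro max) (auto intro!: small[rule_format])
    then have "s e k \<le> coord_diff p k j"
      using w(2)[of k] by (simp add: fun_eq_iff)
    then show ?thesis
      using e by (simp add: s_def mult_le_0_iff)
  qed
  with pW that show thesis by blast
qed

lemma polytrope_greatest:
  assumes "polytrope P"
  obtains p where "p \<in> P" "\<And>q k. q \<in> P \<Longrightarrow> coord_diff q k j \<le> coord_diff p k j"
proof -
  obtain W where W: "finite W" "W \<noteq> {}" "P = tconv W" "convex (c0 ` P)"
    using assms by (auto simp: polytrope_def tropical_polytope_def)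
  show thesis
    by (rule convex_tconv_greatest[OF W(1,2), of j]) (use W that in auto)
qed

lemma tight_rhs_eq:
  assumes "p \<in> P" "\<And>q. q \<in> P \<Longrightarrow> coord_diff q k j \<le> coord_diff p k j"
  shows "tight_rhs P k j = coord_diff p k j"
  unfolding tight_rhs_def using assms by (intro Greatest_equality) auto

lemma coord_diff_tight_vertex:
  "coord_diff (tight_vertex P j) k j = (if k = j then 0 else tight_rhs P k j)"
  by (simp add: tight_vertex_def coord_diff.abs_eq)

text \<open>The greatest element for normalisation at \<open>j\<close> attains the maxima
  \<open>tight_rhs P k j\<close> for all k at once, so its coordinates are those of v_j.\<close>

lemma tight_vertex_greatest:
  assumes "polytrope P"
  shows "tight_vertex P j \<in> P"
    and "q \<in> P \<Longrightarrow> coord_diff q k j \<le> coord_diff (tight_vertex P j) k j"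
proof -
  obtain p where p: "p \<in> P" "\<And>q k. q \<in> P \<Longrightarrow> coord_diff q k j \<le> coord_diff p k j"
    using polytrope_greatest[OF assms] by blast
  have "tight_vertex P j = p"
    by (rule tropical_affine_eqI[of _ j]) (simp add: coord_diff_tight_vertex tight_rhs_eq[OF p(1) p(2)])
  with p show "tight_vertex P j \<in> P"
    and "q \<in> P \<Longrightarrow> coord_diff q k j \<le> coord_diff (tight_vertex P j) k j" by auto
qed

lemma polytrope_tropically_convex: "polytrope P \<Longrightarrow> tropically_convex P"
  by (auto simp: polytrope_def tropical_polytope_def tropically_convex_tconv)

lemma polytrope_eq_tight_inequalities:
  assumes "polytrope P"
  shows "P = {x. \<forall>i j. i \<noteq> j \<longrightarrow> coord_diff x i j \<le> tight_rhs P i j}"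
proof (intro equalityI subsetI)
  fix x assume "x \<in> P"
  show "x \<in> {x. \<forall>i j. i \<noteq> j \<longrightarrow> coord_diff x i j \<le> tight_rhs P i j}"
  proof clarify
    fix i j :: "'a option" assume "i \<noteq> j"
    then show "coord_diff x i j \<le> tight_rhs P i j"
      using tight_vertex_greatest(2)[OF assms \<open>x \<in> P\<close>, of i j]
      by (simp add: coord_diff_tight_vertex)
  qed
next
  fix x assume "x \<in> {x. \<forall>i j. i \<noteq> j \<longrightarrow> coord_diff x i j \<le> tight_rhs P i j}"
  \<comment> \<open>The inequalities say that \<open>x\<close> lies below every v_j after
    normalisation at j, which is what makes it a tropical combination of them.\<close>
  then have "coord_diff x k j \<le> coord_diff (tight_vertex P j) k j" for k j
    by (simp add: coord_diff_tight_vertex)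
  with polytrope_tropically_convex[OF assms] tight_vertex_greatest(1)[OF assms]
  show "x \<in> P" by (rule tropically_convex_memI)
qed

section \<open>Tropical vertices\<close>

lemma tconv_tight_vertices:
  assumes "polytrope P"
  shows "tconv (range (tight_vertex P)) = P"
proof
  show "tconv (range (tight_vertex P)) \<subseteq> P"
    using tight_vertex_greatest(1)[OF assms]
    by (intro tconv_minimal polytrope_tropically_convex assms) auto
  show "P \<subseteq> tconv (range (tight_vertex P))"
  proof
    fix x assume "x \<in> P"
    have "tight_vertex P j \<in> tconv (range (tight_vertex P))" for j
      by (rule subsetD[OF subset_tconv]) simp
    then show "x \<in> tconv (range (tight_vertex P))"
      using tight_vertex_greatest(2)[OF assms \<open>x \<in> P\<close>]
      by (rule tropically_convex_memI[OF tropically_convex_tconv])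
  qed
qed

text \<open>Some generator lies above v_j; it belongs to \<open>P\<close>, where v_j is greatest, so
  the two coincide.\<close>

lemma tight_vertices_subset_generators:
  assumes "polytrope P" "tconv W = P"
  shows "range (tight_vertex P) \<subseteq> W"
proof clarify
  fix j
  have "tight_vertex P j \<in> tconv W"
    using tight_vertex_greatest(1)[OF assms(1)] assms(2) by simp
  then obtain w where w: "w \<in> W"
      "\<And>k. coord_diff (tight_vertex P j) k j \<le> coord_diff w k j"
    by (rule tconv_dominated[of _ _ j]) blast
  have "w \<in> P" using w(1) subset_tconv assms(2) by blast
  then have "tight_vertex P j = w"
    using w(2) tight_vertex_greatest(2)[OF assms(1)]
    by (intro tropical_affine_eqI[of _ j] order.antisym) auto
  with w(1) show "tight_vertex P j \<in> W" by simp
qed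

text \<open>A generating set contained in every generating set is minimal and is the only minimal
  one, as \<open>THE\<close> requires.\<close>

lemma tropical_vertices_eq:
  assumes "polytrope P"
  shows "tropical_vertices P = range (tight_vertex P)"
  unfolding tropical_vertices_def minimal_generators_def
  using tconv_tight_vertices[OF assms] tight_vertices_subset_generators[OF assms]
  by (intro the_equality) blast+

section \<open>Full dimension\<close>

lemma polytrope_interior_point:
  fixes P :: "('d::finite) tropical_affine set"
  assumes P: "polytrope P" and "polytrope_dim P = int CARD('d)"
  obtains z where "\<And>i j. i \<noteq> j \<Longrightarrow> coord_diff z i j < tight_rhs P i j"
proof -
  have "interior (c0 ` P) = rel_interior (c0 ` P)"
    using assms(2) by (simp add: interior_rel_interior_gen polytrope_dim_def)
  moreover have "convex (c0 ` P)" "P \<noteq> {}"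
    using P tight_vertex_greatest(1) by (auto simp: polytrope_def)
  ultimately have "interior (c0 ` P) \<noteq> {}"
    by (simp add: rel_interior_eq_empty)
  then obtain y where y: "y \<in> interior (c0 ` P)" by blast
  then obtain z where z: "y = c0 z" using interior_subset by blast
  have "coord_diff z i j < tight_rhs P i j" if ij: "i \<noteq> j" for i j
  proof -
    let ?a = "option_axis i - option_axis j"
    have "?a \<noteq> 0" using ij inj_option_axis by (auto dest: injD)
    moreover have "c0 ` P \<subseteq> {y. ?a \<bullet> y \<le> tight_rhs P i j}"
      using ij by (subst polytrope_eq_tight_inequalities[OF P]) (auto simp flip: coord_diff_c0)
    then have "y \<in> interior {y. ?a \<bullet> y \<le> tight_rhs P i j}"
      using y interior_mono by blast
    ultimately show ?thesis
      by (simp add: z coord_diff_c0)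
  qed
  with that show thesis by blast
qed

text \<open>v_i = v_j would force c_ji = - c_ij, whereas adding the two strict inequalities at an
  interior point gives 0 < c_ij + c_ji.\<close>

lemma inj_tight_vertex:
  fixes P :: "('d::finite) tropical_affine set"
  assumes "polytrope P" "polytrope_dim P = int CARD('d)"
  shows "inj (tight_vertex P)"
proof (rule injI, rule ccontr)
  fix i j assume eq: "tight_vertex P i = tight_vertex P j" and ij: "i \<noteq> j"
  obtain z where z: "\<And>i j. i \<noteq> j \<Longrightarrow> coord_diff z i j < tight_rhs P i j"
    using polytrope_interior_point[OF assms] by blast
  have "tight_rhs P j i = coord_diff (tight_vertex P i) j i"
    using ij by (simp add: coord_diff_tight_vertex)
  also have "\<dots> = - coord_diff (tight_vertex P j) i j"
    by (simp add: eq coord_diff_swap[of _ j i])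
  also have "\<dots> = - tight_rhs P i j"
    using ij by (simp add: coord_diff_tight_vertex)
  finally have "tight_rhs P j i = - tight_rhs P i j" .
  then show False
    using z[OF ij] z[of j i] ij coord_diff_swap[of z j i] by simp
qed

section \<open>Boundaries of tropical halfspaces\<close>

lemma mem_translated_sectors:
  "x \<in> (\<lambda>x. w + x) ` (\<Union>i\<in>I. closed_sector i) \<longleftrightarrow>
     (\<exists>i\<in>I. \<forall>k. coord_diff w k i \<le> coord_diff x k i)"
proof
  assume "x \<in> (\<lambda>x. w + x) ` (\<Union>i\<in>I. closed_sector i)"
  then show "\<exists>i\<in>I. \<forall>k. coord_diff w k i \<le> coord_diff x k i"
    by (fastforce simp: closed_sector_def coord_diff_plus)
next
  assume "\<exists>i\<in>I. \<forall>k. coord_diff w k i \<le> coord_diff x k i"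
  then obtain i where i: "i \<in> I" "\<And>k. coord_diff w k i \<le> coord_diff x k i" by blast
  \<comment> \<open>The difference of \<open>x\<close> and \<open>w\<close>, built from coordinates
    normalised at \<open>i\<close>.\<close>
  define y where "y = abs_tropical_affine (\<chi> k. coord_diff x k i - coord_diff w k i)"
  have y: "coord_diff y k i = coord_diff x k i - coord_diff w k i" for k
    by (simp add: y_def coord_diff.abs_eq)
  have "x = w + y"
    by (rule tropical_affine_eqI[of _ i]) (simp add: coord_diff_plus y)
  moreover have "y \<in> closed_sector i"
    using i(2) by (simp add: closed_sector_def y)
  ultimately show "x \<in> (\<lambda>x. w + x) ` (\<Union>i\<in>I. closed_sector i)"
    using i(1) by blast
qed

text \<open>The points x for which the minimal coordinate of x - w is attained only at
  \<open>j\<close>.\<close>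

definition open_sector :: "'d::finite tropical_affine \<Rightarrow> 'd option \<Rightarrow> 'd tropical_affine set" where
  "open_sector w j = {x. \<forall>k. k \<noteq> j \<longrightarrow> coord_diff w k j < coord_diff x k j}"

lemma open_open_sector: "open (open_sector w j)"
proof -
  have "c0 ` open_sector w j =
      (\<Inter>k\<in>- {j}. {y. coord_diff w k j < (option_axis k - option_axis j) \<bullet> y})"
  proof (intro equalityI subsetI)
    fix y assume y: "y \<in> (\<Inter>k\<in>- {j}. {y. coord_diff w k j < (option_axis k - option_axis j) \<bullet> y})"
    obtain x where "y = c0 x" using bij_c0 by (metis bij_pointE)
    with y show "y \<in> c0 ` open_sector w j"
      by (auto simp: open_sector_def simp flip: coord_diff_c0)
  qed (auto simp: open_sector_def simp flip: coord_diff_c0)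
  then show ?thesis
    by (auto simp: open_tropical_affine_def intro!: open_INT open_halfspace_gt)
qed

text \<open>If j is in \<open>I\<close>, the open sector lies in the union and so in its interior.
  Otherwise a common point would have x_j - w_j both smaller than and at least x_i - w_i for some i
  in \<open>I\<close>; so the open sector misses the union and, being open, its closure.\<close>

lemma open_sector_disjoint_frontier:
  "open_sector w j \<inter> frontier ((\<lambda>x. w + x) ` (\<Union>i\<in>I. closed_sector i)) = {}"
    (is "_ \<inter> frontier ?H = {}")
proof (cases "j \<in> I")
  case True
  have "open_sector w j \<subseteq> ?H"
  proof
    fix x assume "x \<in> open_sector w j"
    then have "coord_diff w k j \<le> coord_diff x k j" for k
      by (cases "k = j") (auto simp: open_sector_def less_imp_le)
    with True show "x \<in> ?H" unfolding mem_translated_sectors by blast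
  qed
  then have "open_sector w j \<subseteq> interior ?H"
    by (rule interior_maximal[OF _ open_open_sector])
  then show ?thesis by (auto simp: frontier_def)
next
  case False
  have "x \<notin> ?H" if x: "x \<in> open_sector w j" for x
  proof
    assume "x \<in> ?H"
    then obtain i where i: "i \<in> I" "coord_diff w j i \<le> coord_diff x j i"
      unfolding mem_translated_sectors by blast
    then have "coord_diff w i j < coord_diff x i j"
      using x False by (auto simp: open_sector_def)
    with i(2) show False
      using coord_diff_swap[of w j i] coord_diff_swap[of x j i] by simp
  qed
  then have "open_sector w j \<inter> closure ?H = {}"
    by (subst open_Int_closure_eq_empty[OF open_open_sector]) blast
  then show ?thesis by (auto simp: frontier_def)
qed

lemma tropical_simplex_polytrope:
  fixes P :: "('d::finite) tropical_affine set"
  assumes P: "polytrope P" "polytrope_dim P = int CARD('d)"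
  shows "tropical_simplex P"
  unfolding tropical_simplex_def
proof (intro exI conjI notI)
  show "card (range (tight_vertex P)) = CARD('d) + 1"
    using card_image[OF inj_tight_vertex[OF P]] by simp
  show "P = tconv (range (tight_vertex P))"
    using tconv_tight_vertices[OF P(1)] by simp
  assume "\<exists>H. closed_tropical_halfspace H \<and> range (tight_vertex P) \<subseteq> frontier H"
  then obtain w I where front:
      "range (tight_vertex P) \<subseteq> frontier ((\<lambda>x. w + x) ` (\<Union>i\<in>I. closed_sector i))"
    unfolding closed_tropical_halfspace_def by blast
  obtain z where z: "\<And>i j. i \<noteq> j \<Longrightarrow> coord_diff z i j < tight_rhs P i j"
    using polytrope_interior_point[OF P] by blast
  \<comment> \<open>Single coordinates are undefined on the quotient, so w - z is measured relative
    to coordinate 0; this does not affect where the maximum is attained.\<close>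
  let ?g = "\<lambda>k. coord_diff w k None - coord_diff z k None"
  have "Max (range ?g) \<in> range ?g"
    by (rule Max_in) auto
  then obtain j where "Max (range ?g) = ?g j" ..
  then have j: "?g k \<le> ?g j" for k
    using Max_ge[of "range ?g" "?g k"] by simp
  have "tight_vertex P j \<in> open_sector w j"
    unfolding open_sector_def
  proof clarify
    fix k assume kj: "k \<noteq> j"
    \<comment> \<open>Maximality at \<open>j\<close> bounds w_k - w_j by z_k - z_j, which is
      strictly below c_kj, the coordinate k of v_j.\<close>
    have "coord_diff w k j \<le> coord_diff z k j"
      using j[of k] coord_diff_split[of w k None j] coord_diff_split[of z k None j]
      by (simp add: coord_diff_swap[of w None j] coord_diff_swap[of z None j])
    with z[OF kj] kj show "coord_diff w k j < coord_diff (tight_vertex P j) k j"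
      by (simp add: coord_diff_tight_vertex)
  qed
  with front show False
    using open_sector_disjoint_frontier by blast
qed

theorem theorem7:
  fixes P :: "('d::finite) tropical_affine set"
  assumes "polytrope P"
    and "polytrope_dim P = int CARD('d)"
  shows "P = {x. \<forall>i j. i \<noteq> j \<longrightarrow> coord_diff x i j \<le> tight_rhs P i j} \<and>
    inj (tight_vertex P) \<and>
    tropical_vertices P = range (tight_vertex P) \<and>
    tropical_simplex P"
  by (intro conjI polytrope_eq_tight_inequalities inj_tight_vertex tropical_vertices_eq
      tropical_simplex_polytrope assms)

end
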